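(* Let $C\subseteq\mathbb{R}^2$ be the Sierpiński carpet. For every $\varepsilon>0$ there is a 1-Lipschitz map $f:C\to\mathbb{R}^2$ such that $|f(x)-x|\le\varepsilon$ for every $x\in C$ and $f(C)$ is contained in the union of finitely many line segments.
   Context: $|\cdot|$ is the Euclidean norm and 1-Lipschitz is with respect to it. The Sierpiński carpet is the unique nonempty compact set $C\subseteq[0,1]^2$ with $C=\bigcup_{(a,b)\in\{0,1,2\}^2\setminus\{(1,1)\}}\left(\tfrac13 C+\tfrac13(a,b)\right)$. *)

theory Defs
  imports "HOL-Analysis.Analysis"
begin

definition carpet_digits :: "(real \<times> real) set" where
  "carpet_digits = {0, 1, 2} \<times> {0, 1, 2} - {(1, 1)}"

definition carpet_step :: "(real^2) set \<Rightarrow> (real^2) set" where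
  "carpet_step C =
     (\<Union>(a, b)\<in>carpet_digits. (\<lambda>x. (1/3) *\<^sub>R x + (1/3) *\<^sub>R vector [a, b]) ` C)"

definition is_sierpinski_carpet :: "(real^2) set \<Rightarrow> bool" where
  "is_sierpinski_carpet C \<longleftrightarrow>
     C \<noteq> {} \<and> compact C \<and> C \<subseteq> {x. \<forall>i. 0 \<le> x $ i \<and> x $ i \<le> 1} \<and> C = carpet_step C"

definition sierpinski_carpet :: "(real^2) set" where
  "sierpinski_carpet = (THE C. is_sierpinski_carpet C)"

lemma carpet_step_mono: "A \<subseteq> B \<Longrightarrow> carpet_step A \<subseteq> carpet_step B"
  unfolding carpet_step_def by fastforce

lemma compact_carpet_step:
  assumes "compact C" shows "compact (carpet_step C)"
proof -
  have "compact ((\<lambda>x. (1/3) *\<^sub>R x + (1/3) *\<^sub>R (v::real^2)) ` C)" for v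
    by (intro compact_continuous_image continuous_intros assms)
  moreover have "finite carpet_digits"
    by (simp add: carpet_digits_def)
  ultimately show ?thesis
    unfolding carpet_step_def by (auto intro!: compact_UN)
qed

lemma carpet_unique_aux:
  assumes C: "is_sierpinski_carpet C" and D: "is_sierpinski_carpet D"
  shows "C \<subseteq> D"
proof -
  have "compact C" "C \<noteq> {}" "closed D" "D \<noteq> {}" and CC: "C = carpet_step C" and DD: "D = carpet_step D"
    using C D by (auto simp: is_sierpinski_carpet_def compact_imp_closed)
  have "continuous_on C (\<lambda>x. infdist x D)"
    by (intro continuous_intros)
  then obtain x where x: "x \<in> C" "\<And>y. y \<in> C \<Longrightarrow> infdist y D \<le> infdist x D"
    using continuous_attains_sup[OF \<open>compact C\<close> \<open>C \<noteq> {}\<close>] by blast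
  have "x \<in> carpet_step C" using x(1) CC by simp
  then obtain a b y where ab: "(a, b) \<in> carpet_digits" and y: "y \<in> C"
    and xy: "x = (1/3) *\<^sub>R y + (1/3) *\<^sub>R vector [a, b]"
    unfolding carpet_step_def by blast
  obtain d where d: "d \<in> D" "infdist y D = dist y d"
    using infdist_attains_inf[OF \<open>closed D\<close> \<open>D \<noteq> {}\<close>] by metis
  define e where "e = (1/3) *\<^sub>R d + (1/3) *\<^sub>R (vector [a, b] :: real^2)"
  have "e \<in> carpet_step D"
    unfolding carpet_step_def e_def using ab d(1) by blast
  then have "e \<in> D" using DD by simp
  have "x - e = (1/3) *\<^sub>R (y - d)"
    by (simp add: xy e_def algebra_simps)
  then have "dist x e = dist y d / 3"
    by (simp add: dist_norm)
  then have "infdist x D \<le> infdist y D / 3"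
    using infdist_le[OF \<open>e \<in> D\<close>, of x] d(2) by simp
  then have "infdist x D \<le> 0"
    using x(2)[OF y] by simp
  then have "infdist z D = 0" if "z \<in> C" for z
    using x(2)[OF that] infdist_nonneg[of z D] by simp
  then show ?thesis
    using in_closed_iff_infdist_zero[OF \<open>closed D\<close> \<open>D \<noteq> {}\<close>] by blast
qed

lemma ex1_sierpinski_carpet: "\<exists>!C. is_sierpinski_carpet C"
proof -
  define Q where "Q = {x :: real^2. \<forall>i. 0 \<le> x $ i \<and> x $ i \<le> 1}"
  have Qcb: "Q = cbox (\<chi> i. 0) (\<chi> i. 1)"
    by (auto simp: Q_def mem_box_cart)
  then have Q: "compact Q" by simp
  have stepQ: "carpet_step Q \<subseteq> Q"
    unfolding carpet_step_def Q_def
    by (auto simp: carpet_digits_def forall_2)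
  define F where "F = (\<lambda>X. carpet_step X \<inter> Q)"
  have "mono F"
    unfolding F_def by (intro monoI) (use carpet_step_mono in blast)
  define C where "C = gfp F"
  have CF: "C = carpet_step C \<inter> Q"
    using gfp_unfold[OF \<open>mono F\<close>] by (simp add: C_def F_def)
  then have CQ: "C \<subseteq> Q" by blast
  have CT: "C = carpet_step C"
    using CF carpet_step_mono[OF CQ] stepQ by blast
  have clQ: "closure C \<subseteq> Q"
    using CQ Q by (simp add: closure_minimal compact_imp_closed)
  have compcl: "compact (closure C)"
    using CQ Q bounded_subset compact_closure compact_imp_bounded by blast
  have "C \<subseteq> carpet_step (closure C)"
    using CT carpet_step_mono[OF closure_subset] by blast
  then have "closure C \<subseteq> carpet_step (closure C)"
    by (rule closure_minimal) (intro compact_imp_closed compact_carpet_step compcl)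
  then have "closure C \<subseteq> C"
    unfolding C_def by (intro gfp_upperbound) (use clQ in \<open>auto simp: F_def C_def\<close>)
  then have "compact C"
    using compcl closure_subset by (metis subset_antisym)
  have z: "vector [0, 0] = (0 :: real^2)"
    by (simp add: vec_eq_iff forall_2)
  have "(0::real^2) \<in> carpet_step {0}"
    unfolding carpet_step_def carpet_digits_def
    by (rule UN_I[of "(0, 0)"]) (auto simp: z)
  then have "{0} \<subseteq> C"
    unfolding C_def by (intro gfp_upperbound) (auto simp: F_def Q_def)
  then have "is_sierpinski_carpet C"
    using \<open>compact C\<close> CQ CT by (auto simp: is_sierpinski_carpet_def Q_def)
  then show ?thesis
    using carpet_unique_aux by (blast intro: subset_antisym)
qed

lemma is_sierpinski_carpet_sierpinski_carpet: "is_sierpinski_carpet sierpinski_carpet"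
  unfolding sierpinski_carpet_def by (rule theI'[OF ex1_sierpinski_carpet])

end

theory Submission
  imports Defs
begin

text \<open>
  If finitely many tubes \<open>\<bar>v\<^sub>j \<bullet> p - \<alpha>\<^sub>j\<bar> < \<bar>v\<^sub>j\<bar>\<^sup>2/2\<close> cover a set, then the proximal map
  of the polyhedral convex function \<open>g q = Max\<^sub>T (b\<^sub>T \<bullet> q + \<bar>b\<^sub>T\<bar>\<^sup>2/2 - (\<Sum>j\<in>T. \<alpha>\<^sub>j))\<close>,
  \<open>b\<^sub>T = (\<Sum>j\<in>T. v\<^sub>j)\<close>, is nonexpansive, moves points by at most \<open>\<Sum>\<bar>v\<^sub>j\<bar>\<close>, and sends the
  set into the kinks of \<open>g\<close>, which lie on finitely many lines.

  The carpet has such covers with arbitrarily small \<open>\<Sum>\<bar>v\<^sub>j\<bar>\<close>. It is invariant under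
  multiplication by 3 modulo 1 and misses the central square, on which
  \<open>sin\<^sup>2(\<pi>x) sin\<^sup>2(\<pi>y)\<close> concentrates. Taking a high power of this function, some trigonometric
  polynomial of mean zero is bounded away from 0 on the carpet. Averaging along orbits, each
  point \<open>p\<close> of the carpet has an integer frequency \<open>k \<noteq> 0\<close> from a fixed finite set such that
  \<open>\<Sum>j<N. exp(2\<pi>i 3\<^sup>j k\<bullet>p)\<close> is of order \<open>N\<close>. By orthogonality the set of real numbers \<open>k\<bullet>p\<close>
  for which this can happen has measure \<open>O(1/N)\<close>.
\<close>

subsection \<open>Collapsing tubes by a proximal map\<close>

text \<open>Take \<open>f p\<close> to minimize half the squared distance to \<open>p\<close> plus
  \<open>g\<close>. Comparing the minimum with points on the segment towards \<open>z\<close> gives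
  the variational inequality, and adding two instances of it makes \<open>f\<close>
  nonexpansive.\<close>

lemma ex_nonexpansive_prox:
  fixes g :: "'a::euclidean_space \<Rightarrow> real"
  assumes cvx: "convex_on UNIV g" and lip: "L-lipschitz_on UNIV g"
  shows "\<exists>f. 1-lipschitz_on UNIV f \<and> (\<forall>p z. (p - f p) \<bullet> (z - f p) \<le> g z - g (f p))"
proof -
  have L: "L \<ge> 0" and gL: "g x - g y \<le> L * norm (x - y)" for x y
    using lipschitz_on_nonneg[OF lip] lipschitz_onD[OF lip, of x y]
    by (auto simp: dist_norm)
  have gcont: "continuous_on UNIV g"
    by (rule lipschitz_on_continuous_on[OF lip])
  have ex_min: "\<exists>q. \<forall>z. (norm (p - q))\<^sup>2 / 2 + g q \<le> (norm (p - z))\<^sup>2 / 2 + g z" for p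
  proof -
    \<comment> \<open>Radius \<open>2 * L\<close> suffices for a global minimum: farther out the
      quadratic term exceeds \<open>L * norm (p - z)\<close>, the most that \<open>g\<close> can
      drop, so \<open>z\<close> does no better than \<open>p\<close> itself.\<close>
    have "\<exists>q\<in>cball p (2 * L). \<forall>z\<in>cball p (2 * L).
        (norm (p - q))\<^sup>2 / 2 + g q \<le> (norm (p - z))\<^sup>2 / 2 + g z"
      by (rule continuous_attains_inf)
        (use L in \<open>auto intro!: continuous_intros continuous_on_subset[OF gcont]\<close>)
    then obtain q where min: "\<forall>z\<in>cball p (2 * L).
        (norm (p - q))\<^sup>2 / 2 + g q \<le> (norm (p - z))\<^sup>2 / 2 + g z"
      by blast
    have q: "(norm (p - q))\<^sup>2 / 2 + g q \<le> (norm (p - z))\<^sup>2 / 2 + g z"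
      if "norm (p - z) \<le> 2 * L" for z
      using min that by (simp add: dist_norm)
    have "(norm (p - q))\<^sup>2 / 2 + g q \<le> (norm (p - z))\<^sup>2 / 2 + g z" for z
    proof (cases "norm (p - z) \<le> 2 * L")
      case False
      have "(norm (p - q))\<^sup>2 / 2 + g q \<le> g p"
        using q[of p] L by simp
      also have "\<dots> \<le> L * norm (p - z) + g z"
        using gL[of p z] by simp
      also have "L * norm (p - z) \<le> (norm (p - z))\<^sup>2 / 2"
        using False mult_right_mono[of "2 * L" "norm (p - z)" "norm (p - z)"]
        by (simp add: power2_eq_square)
      finally show ?thesis by simp
    qed (rule q)
    then show ?thesis by blast
  qed
  define f where "f p = (SOME q. \<forall>z. (norm (p - q))\<^sup>2 / 2 + g q \<le> (norm (p - z))\<^sup>2 / 2 + g z)" for p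
  have f: "(norm (p - f p))\<^sup>2 / 2 + g (f p) \<le> (norm (p - z))\<^sup>2 / 2 + g z" for p z
    using someI_ex[OF ex_min[of p]] by (simp add: f_def)
  have var: "(p - f p) \<bullet> (z - f p) \<le> g z - g (f p)" for p z
  proof -
    define q where "q = f p"
    \<comment> \<open>Compare \<open>q\<close> with the point at parameter \<open>t\<close> between
      \<open>q\<close> and \<open>z\<close>, bound \<open>g\<close> there by convexity, and divide
      by \<open>t\<close>. The leftover quadratic term disappears as \<open>t\<close> tends to
      0.\<close>
    have le: "(p - q) \<bullet> (z - q) \<le> t * (norm (z - q))\<^sup>2 / 2 + (g z - g q)" if t: "0 < t" "t < 1" for t
    proof -
      have "g ((1 - t) *\<^sub>R q + t *\<^sub>R z) \<le> (1 - t) * g q + t * g z"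
        using convex_onD[OF cvx, of t q z] t by simp
      moreover have "(norm (p - q))\<^sup>2 / 2 + g q
          \<le> (norm (p - ((1 - t) *\<^sub>R q + t *\<^sub>R z)))\<^sup>2 / 2 + g ((1 - t) *\<^sub>R q + t *\<^sub>R z)"
        unfolding q_def by (rule f)
      moreover have "p - ((1 - t) *\<^sub>R q + t *\<^sub>R z) = (p - q) - t *\<^sub>R (z - q)"
        by (simp add: algebra_simps)
      moreover have "(norm ((p - q) - t *\<^sub>R (z - q)))\<^sup>2
          = (norm (p - q))\<^sup>2 - 2 * t * ((p - q) \<bullet> (z - q)) + t\<^sup>2 * (norm (z - q))\<^sup>2"
        unfolding power2_norm_eq_inner
        by (simp add: inner_diff_left inner_diff_right inner_commute power2_eq_square algebra_simps)
      ultimately have "t * ((p - q) \<bullet> (z - q)) \<le> t * (t * (norm (z - q))\<^sup>2 / 2 + (g z - g q))"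
        by (simp add: algebra_simps power2_eq_square)
      then show ?thesis using t by simp
    qed
    have "((\<lambda>t. t * (norm (z - q))\<^sup>2 / 2 + (g z - g q)) \<longlongrightarrow> 0 * (norm (z - q))\<^sup>2 / 2 + (g z - g q)) (at_right 0)"
      by (intro tendsto_intros) simp_all
    moreover have "\<forall>\<^sub>F t in at_right 0. (p - q) \<bullet> (z - q) \<le> t * (norm (z - q))\<^sup>2 / 2 + (g z - g q)"
      using eventually_at_right_less[of 0] eventually_at_right_real[of 0 1]
      by (auto elim!: eventually_mono intro: le)
    ultimately show ?thesis
      unfolding q_def by (auto intro: tendsto_lowerbound)
  qed
  have "1-lipschitz_on UNIV f"
  proof (rule lipschitz_onI)
    fix x y :: 'a
    \<comment> \<open>This is the sum of the variational inequality for \<open>x\<close> tested at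
      \<open>f y\<close> and the one for \<open>y\<close> tested at \<open>f x\<close>; the values
      of \<open>g\<close> cancel.\<close>
    have "(norm (f x - f y))\<^sup>2 \<le> (x - y) \<bullet> (f x - f y)"
      using var[of x "f y"] var[of y "f x"]
      unfolding power2_norm_eq_inner
      by (simp add: inner_diff_left inner_diff_right inner_commute)
    also have "\<dots> \<le> norm (x - y) * norm (f x - f y)"
      by (rule norm_cauchy_schwarz)
    finally show "dist (f x) (f y) \<le> 1 * dist x y"
      by (cases "f x = f y") (auto simp: dist_norm power2_eq_square)
  qed simp
  then show ?thesis using var by blast
qed

text \<open>If \<open>f p\<close> avoids all kinks, then \<open>g\<close> is affine near
  \<open>f p\<close> with some gradient \<open>b T\<close>, and optimality gives
  \<open>p = f p + b T\<close>. For \<open>p\<close> in the tube of \<open>j\<close>, adding or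
  removing \<open>j\<close> in \<open>T\<close> would then exceed the maximum that defines
  \<open>g\<close>.\<close>

lemma ex_nonexpansive_collapse_tubes:
  fixes v :: "'i \<Rightarrow> 'a::euclidean_space" and \<alpha> :: "'i \<Rightarrow> real"
  assumes J: "finite J"
  shows "\<exists>f H. 1-lipschitz_on UNIV f \<and> (\<forall>p. norm (f p - p) \<le> (\<Sum>j\<in>J. norm (v j))) \<and>
    finite H \<and> (\<forall>(u, c)\<in>H. u \<noteq> 0) \<and>
    (\<forall>p. (\<exists>j\<in>J. \<bar>v j \<bullet> p - \<alpha> j\<bar> < (norm (v j))\<^sup>2 / 2) \<longrightarrow> (\<exists>(u, c)\<in>H. u \<bullet> f p = c))"
proof -
  define b where "b T = sum v T" for T
  \<comment> \<open>The quadratic term expresses exchanges through \<open>p\<close> rather than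
    \<open>q\<close>: at \<open>q = p - b T\<close>, adding \<open>j\<close> to \<open>T\<close>
    changes the affine piece by
    \<open>(norm (v j))\<^sup>2 / 2 + (v j \<bullet> p - \<alpha> j)\<close>. Removing
    \<open>j\<close> gives the same with the opposite sign of the bracket.\<close>
  define \<gamma> where "\<gamma> T = (norm (b T))\<^sup>2 / 2 - sum \<alpha> T" for T
  define g where "g q = Max ((\<lambda>T. b T \<bullet> q + \<gamma> T) ` Pow J)" for q
  define L where "L = (\<Sum>j\<in>J. norm (v j))"
  have L: "L \<ge> 0" by (simp add: L_def sum_nonneg)
  have bL: "norm (b T) \<le> L" if "T \<subseteq> J" for T
  proof -
    have "norm (b T) \<le> (\<Sum>j\<in>T. norm (v j))" by (simp add: b_def norm_sum)
    also have "\<dots> \<le> L" unfolding L_def by (rule sum_mono2) (use J that in auto)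
    finally show ?thesis .
  qed
  have g_ge: "b T \<bullet> q + \<gamma> T \<le> g q" if "T \<subseteq> J" for T q
    unfolding g_def by (rule Max_ge) (use J that in auto)
  have g_attained: "\<exists>T\<subseteq>J. g q = b T \<bullet> q + \<gamma> T" for q
  proof -
    have "g q \<in> (\<lambda>T. b T \<bullet> q + \<gamma> T) ` Pow J"
      unfolding g_def by (rule Max_in) (use J in auto)
    then show ?thesis by auto
  qed
  have cvx: "convex_on UNIV g"
  proof (rule convex_onI)
    fix t :: real and x y :: 'a
    assume t: "0 < t" "t < 1"
    obtain T where T: "T \<subseteq> J" "g ((1 - t) *\<^sub>R x + t *\<^sub>R y) = b T \<bullet> ((1 - t) *\<^sub>R x + t *\<^sub>R y) + \<gamma> T"
      using g_attained by blast
    then have "g ((1 - t) *\<^sub>R x + t *\<^sub>R y) = (1 - t) * (b T \<bullet> x + \<gamma> T) + t * (b T \<bullet> y + \<gamma> T)"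
      by (simp add: inner_add_right algebra_simps)
    also have "\<dots> \<le> (1 - t) * g x + t * g y"
      using t T(1) by (intro add_mono mult_left_mono g_ge) auto
    finally show "g ((1 - t) *\<^sub>R x + t *\<^sub>R y) \<le> (1 - t) * g x + t * g y" .
  qed simp
  have gL: "g x - g y \<le> L * norm (x - y)" for x y
  proof -
    obtain T where T: "T \<subseteq> J" "g x = b T \<bullet> x + \<gamma> T"
      using g_attained by blast
    then have "g x - g y \<le> b T \<bullet> (x - y)"
      using g_ge[of T y] by (simp add: inner_diff_right)
    also have "\<dots> \<le> norm (b T) * norm (x - y)" by (rule norm_cauchy_schwarz)
    also have "\<dots> \<le> L * norm (x - y)" by (intro mult_right_mono bL T) auto
    finally show ?thesis .
  qed
  have lip: "L-lipschitz_on UNIV g"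
  proof (rule lipschitz_onI)
    fix x y :: 'a
    show "dist (g x) (g y) \<le> L * dist x y"
      using gL[of x y] gL[of y x] by (auto simp: dist_norm norm_minus_commute)
  qed (rule L)
  obtain f where f_lip: "1-lipschitz_on UNIV f"
    and f: "\<And>p z. (p - f p) \<bullet> (z - f p) \<le> g z - g (f p)"
    using ex_nonexpansive_prox[OF cvx lip] by blast
  have f_near: "norm (f p - p) \<le> L" for p
  proof -
    \<comment> \<open>Test the variational inequality at \<open>z = p\<close>.\<close>
    have "norm (p - f p) * norm (p - f p) \<le> L * norm (p - f p)"
      using f[of p p] gL[of p "f p"] by (simp add: dot_square_norm power2_eq_square)
    then show ?thesis
      using L by (cases "p = f p") (auto simp: norm_minus_commute)
  qed
  \<comment> \<open>Every kink of \<open>g\<close> lies on a hyperplane where two affine pieces with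
    different gradients agree. Requiring \<open>b T \<noteq> b T'\<close> keeps the normals
    nonzero.\<close>
  define H where "H = (\<lambda>(T, T'). (b T - b T', \<gamma> T' - \<gamma> T)) ` {(T, T') \<in> Pow J \<times> Pow J. b T \<noteq> b T'}"
  have "finite H"
    unfolding H_def using J by (intro finite_imageI finite_subset[of "Collect _" "Pow J \<times> Pow J"]) auto
  moreover have "\<forall>(u, c)\<in>H. u \<noteq> 0" by (auto simp: H_def)
  moreover have "\<exists>(u, c)\<in>H. u \<bullet> f p = c"
    if j: "j \<in> J" and tube: "\<bar>v j \<bullet> p - \<alpha> j\<bar> < (norm (v j))\<^sup>2 / 2" for p j
  proof (rule ccontr)
    assume no: "\<not> (\<exists>(u, c)\<in>H. u \<bullet> f p = c)"
    define q where "q = f p"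
    obtain T where T: "T \<subseteq> J" "g q = b T \<bullet> q + \<gamma> T"
      using g_attained by blast
    \<comment> \<open>Away from \<open>H\<close>, all pieces that attain the maximum at
      \<open>q\<close> are the same affine function.\<close>
    have same: "b T' = b T \<and> \<gamma> T' = \<gamma> T" if T': "T' \<subseteq> J" "g q = b T' \<bullet> q + \<gamma> T'" for T'
    proof -
      have "b T' = b T"
      proof (rule ccontr)
        assume "b T' \<noteq> b T"
        then have "(b T' - b T, \<gamma> T - \<gamma> T') \<in> H"
          using T T' by (auto simp: H_def)
        moreover have "(b T' - b T) \<bullet> q = \<gamma> T - \<gamma> T'"
          using T T' by (simp add: inner_diff_left)
        ultimately show False using no by (auto simp: q_def)
      qed
      then show ?thesis using T T' by simp
    qed
    \<comment> \<open>Pieces strictly below the maximum at \<open>q\<close> stay below nearby by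
      continuity, and the others coincide with the piece of \<open>T\<close>.\<close>
    have "\<forall>\<^sub>F z in nhds q. \<forall>T'\<in>Pow J. b T' \<bullet> z + \<gamma> T' \<le> b T \<bullet> z + \<gamma> T"
    proof (rule eventually_ball_finite)
      show "\<forall>T'\<in>Pow J. \<forall>\<^sub>F z in nhds q. b T' \<bullet> z + \<gamma> T' \<le> b T \<bullet> z + \<gamma> T"
      proof
        fix T' assume "T' \<in> Pow J"
        then have T': "T' \<subseteq> J" by simp
        show "\<forall>\<^sub>F z in nhds q. b T' \<bullet> z + \<gamma> T' \<le> b T \<bullet> z + \<gamma> T"
        proof (cases "g q = b T' \<bullet> q + \<gamma> T'")
          case True
          then show ?thesis using same[OF T'] by simp
        next
          case False
          then have "b T \<bullet> q + \<gamma> T - (b T' \<bullet> q + \<gamma> T') > 0"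
            using g_ge[OF T', of q] T by simp
          moreover have "((\<lambda>z. b T \<bullet> z + \<gamma> T - (b T' \<bullet> z + \<gamma> T'))
              \<longlongrightarrow> b T \<bullet> q + \<gamma> T - (b T' \<bullet> q + \<gamma> T')) (nhds q)"
            by (intro tendsto_intros filterlim_ident)
          ultimately have "\<forall>\<^sub>F z in nhds q. b T \<bullet> z + \<gamma> T - (b T' \<bullet> z + \<gamma> T') > 0"
            by (rule order_tendstoD(1)[rotated])
          then show ?thesis by (rule eventually_mono) simp
        qed
      qed
    qed (use J in simp)
    then have "\<forall>\<^sub>F z in nhds q. g z = b T \<bullet> z + \<gamma> T"
    proof (rule eventually_mono)
      fix z assume le: "\<forall>T'\<in>Pow J. b T' \<bullet> z + \<gamma> T' \<le> b T \<bullet> z + \<gamma> T"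
      obtain T' where T': "T' \<subseteq> J" "g z = b T' \<bullet> z + \<gamma> T'"
        using g_attained by blast
      have "b T' \<bullet> z + \<gamma> T' \<le> b T \<bullet> z + \<gamma> T"
        using bspec[OF le, of T'] T'(1) by blast
      then show "g z = b T \<bullet> z + \<gamma> T"
        using T'(2) g_ge[OF T(1), of z] by linarith
    qed
    then obtain r where r: "r > 0" "\<And>z. dist z q < r \<Longrightarrow> g z = b T \<bullet> z + \<gamma> T"
      by (auto simp: eventually_nhds_metric)
    \<comment> \<open>The vector \<open>w\<close> measures the failure of the first-order condition
      \<open>p - q = b T\<close>. A short step from \<open>q\<close> along \<open>w\<close> stays
      where \<open>g\<close> is affine, and the variational inequality there forces
      \<open>w \<bullet> w \<le> 0\<close>.\<close>
    define w where "w = p - q - b T"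
    have "w = 0"
    proof (rule ccontr)
      assume "w \<noteq> 0"
      define s where "s = r / (2 * norm w)"
      have s: "s > 0" using r \<open>w \<noteq> 0\<close> by (simp add: s_def)
      have "dist (q + s *\<^sub>R w) q < r"
        using r \<open>w \<noteq> 0\<close> by (simp add: dist_norm s_def)
      then have "g (q + s *\<^sub>R w) - g q = b T \<bullet> (s *\<^sub>R w)"
        using r(2) T by (simp add: inner_add_right)
      then have "(p - q) \<bullet> (s *\<^sub>R w) \<le> b T \<bullet> (s *\<^sub>R w)"
        using f[of p "q + s *\<^sub>R w"] by (simp add: q_def)
      then have "w \<bullet> (s *\<^sub>R w) \<le> 0"
        unfolding w_def inner_diff_left by linarith
      then have "s * (w \<bullet> w) \<le> 0" by simp
      moreover have "s * (w \<bullet> w) > 0" using s \<open>w \<noteq> 0\<close> by simp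
      ultimately show False by simp
    qed
    then have p: "p = q + b T" by (simp add: w_def algebra_simps)
    \<comment> \<open>Switching the membership of \<open>j\<close> in \<open>T\<close> would give a larger value at \<open>q\<close>.\<close>
    show False
    proof (cases "j \<in> T")
      case True
      have fT: "finite T" using J T finite_subset by blast
      have flip: "b (T - {j}) = b T - v j" "sum \<alpha> (T - {j}) = sum \<alpha> T - \<alpha> j"
        using True fT by (simp_all add: b_def sum_diff1)
      have "b (T - {j}) \<bullet> q + \<gamma> (T - {j}) - (b T \<bullet> q + \<gamma> T)
          = (norm (v j))\<^sup>2 / 2 - (v j \<bullet> p - \<alpha> j)"
        unfolding \<gamma>_def flip p power2_norm_eq_inner
        by (simp add: inner_diff_left inner_diff_right inner_add_right inner_commute field_simps)
      moreover have "b (T - {j}) \<bullet> q + \<gamma> (T - {j}) \<le> g q"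
        using T by (intro g_ge) auto
      ultimately show False using T tube by linarith
    next
      case False
      have fT: "finite T" using J T finite_subset by blast
      have flip: "b (insert j T) = b T + v j" "sum \<alpha> (insert j T) = sum \<alpha> T + \<alpha> j"
        using False fT by (simp_all add: b_def)
      have "b (insert j T) \<bullet> q + \<gamma> (insert j T) - (b T \<bullet> q + \<gamma> T)
          = (norm (v j))\<^sup>2 / 2 + (v j \<bullet> p - \<alpha> j)"
        unfolding \<gamma>_def flip p power2_norm_eq_inner
        by (simp add: inner_add_left inner_add_right inner_commute field_simps)
      moreover have "b (insert j T) \<bullet> q + \<gamma> (insert j T) \<le> g q"
        using T j by (intro g_ge) auto
      ultimately show False using T tube by linarith
    qed
  qed
  ultimately show ?thesis
    using f_lip f_near unfolding L_def by blast
qed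

text \<open>In the orthogonal frame of \<open>u\<close> and its quarter turn \<open>w\<close>, the
  line is \<open>m + s *\<^sub>R w\<close>, with \<open>m\<close> its point nearest the origin.
  Cauchy-Schwarz bounds \<open>s\<close> by \<open>R / norm u\<close>.\<close>

lemma line_Int_cball_subset_segment:
  fixes u :: "real^2"
  assumes u: "u \<noteq> 0"
  shows "\<exists>a b. {q \<in> cball 0 R. u \<bullet> q = c} \<subseteq> closed_segment a b"
proof (cases "R \<ge> 0")
  case False
  then have "{q \<in> cball 0 R. u \<bullet> q = c} = {}" by auto
  then show ?thesis by blast
next
  case True
  define w :: "real^2" where "w = vector [- (u $ 2), u $ 1]"
  define d where "d = (norm u)\<^sup>2"
  have d: "d = (u$1)\<^sup>2 + (u$2)\<^sup>2" "d > 0"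
    using u by (auto simp: d_def norm_vec_def L2_set_def sum_2 simp flip: zero_less_norm_iff)
  have nw: "norm w = norm u"
    by (simp add: w_def norm_vec_def L2_set_def sum_2 add.commute)
  define k where "k = R / norm u"
  have k: "k \<ge> 0" using True by (simp add: k_def)
  define m where "m = (c / d) *\<^sub>R u"
  have "q \<in> closed_segment (m - k *\<^sub>R w) (m + k *\<^sub>R w)" if q: "norm q \<le> R" "u \<bullet> q = c" for q
  proof -
    define s where "s = (w \<bullet> q) / d"
    have "d * (q $ 1) = c * u$1 + (w \<bullet> q) * w$1" "d * (q $ 2) = c * u$2 + (w \<bullet> q) * w$2"
      using q(2) by (auto simp: d w_def inner_vec_def sum_2 power2_eq_square algebra_simps)
    then have qeq: "q = m + s *\<^sub>R w"
      using d(2) by (auto simp: vec_eq_iff forall_2 m_def s_def field_simps)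
    have "\<bar>w \<bullet> q\<bar> \<le> norm u * R"
      using Cauchy_Schwarz_ineq2[of w q] q(1) nw mult_left_mono[of "norm q" R "norm u"] by simp
    then have "\<bar>s\<bar> \<le> k"
      using u by (simp add: s_def k_def d_def power2_eq_square field_simps)
    show ?thesis
    proof (cases "k = 0")
      case True
      then show ?thesis using qeq \<open>\<bar>s\<bar> \<le> k\<close> by simp
    next
      case False
      define t where "t = (s + k) / (2 * k)"
      have "0 \<le> t" "t \<le> 1"
        using False k \<open>\<bar>s\<bar> \<le> k\<close> by (auto simp: t_def field_simps)
      moreover have "s = (2 * t - 1) * k" using False by (simp add: t_def field_simps)
      then have "q = (1 - t) *\<^sub>R (m - k *\<^sub>R w) + t *\<^sub>R (m + k *\<^sub>R w)"
        by (simp add: qeq algebra_simps flip: scaleR_add_left)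
      ultimately show ?thesis unfolding closed_segment_def by blast
    qed
  qed
  then show ?thesis by (auto simp: subset_eq)
qed

subsection \<open>Lacunary exponential sums\<close>

definition unit_char :: "real \<Rightarrow> complex" where
  "unit_char t = cis (2 * pi * t)"

lemma unit_char_add: "unit_char (s + t) = unit_char s * unit_char t"
  by (simp add: unit_char_def cis_mult distrib_left)

lemma unit_char_minus: "unit_char (- t) = cnj (unit_char t)"
  by (simp add: unit_char_def cis_cnj)

lemma norm_unit_char [simp]: "norm (unit_char t) = 1"
  by (simp add: unit_char_def)

lemma unit_char_of_int [simp]: "unit_char (of_int n) = 1"
  by (simp add: unit_char_def)

lemma unit_char_add_of_int [simp]: "unit_char (t + of_int n) = unit_char t"
  by (simp add: unit_char_add)

lemma unit_char_power: "unit_char t ^ n = unit_char (real n * t)"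
  by (simp add: unit_char_def Complex.DeMoivre mult_ac)

lemma unit_char_eq_1_iff: "unit_char t = 1 \<longleftrightarrow> t \<in> \<int>"
proof
  assume "unit_char t = 1"
  then have "cos (2 * pi * t) = 1" by (simp add: unit_char_def cis.code complex_eq_iff)
  then obtain n :: int where "2 * pi * t = of_int n * 2 * pi"
    by (auto simp: cos_one_2pi_int)
  then have "t = of_int n" by simp
  then show "t \<in> \<int>" by simp
qed (auto elim!: Ints_cases)

lemma norm_unit_char_diff_le: "norm (unit_char s - unit_char t) \<le> 2 * pi * \<bar>s - t\<bar>"
proof -
  have "unit_char s - unit_char t = unit_char t * (unit_char (s - t) - 1)"
    by (simp add: algebra_simps flip: unit_char_add)
  then have "norm (unit_char s - unit_char t) = norm (unit_char (s - t) - 1)"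
    by (simp add: norm_mult)
  also have "\<dots> = 2 * \<bar>sin (pi * (s - t))\<bar>"
    using dist_exp_i_1[of "2 * pi * (s - t)"] by (simp add: unit_char_def cis_conv_exp mult.assoc)
  also have "\<dots> \<le> 2 * \<bar>pi * (s - t)\<bar>"
    using abs_sin_x_le_abs_x by simp
  finally show ?thesis by (simp add: abs_mult)
qed

lemma norm_one_minus_unit_char_squared: "(norm (1 - unit_char t))\<^sup>2 = 4 * (sin (pi * t))\<^sup>2"
  using dist_exp_i_1[of "2 * pi * t"]
  by (simp add: unit_char_def cis_conv_exp mult.assoc norm_minus_commute power_mult_distrib)

text \<open>The terms are the powers of a root of unity \<open>z \<noteq> 1\<close> with
  \<open>z ^ Q = 1\<close>, so the geometric sum vanishes.\<close>

lemma sum_unit_char_period: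
  assumes Q: "Q > 0" and r: "\<not> int Q dvd r"
  shows "(\<Sum>i<Q. unit_char (of_int r * (real i / real Q))) = 0"
proof -
  define z where "z = unit_char (of_int r / real Q)"
  have "of_int r / real Q \<notin> \<int>"
  proof
    assume "of_int r / real Q \<in> \<int>"
    then obtain k :: int where "of_int r / real Q = of_int k" by (auto elim: Ints_cases)
    then have "real_of_int r = of_int (k * int Q)" using Q by (simp add: field_simps)
    then have "r = k * int Q" by linarith
    then show False using r by simp
  qed
  then have "z \<noteq> 1" by (simp add: z_def unit_char_eq_1_iff)
  moreover have "z ^ Q = 1" using Q by (simp add: z_def unit_char_power)
  ultimately have "(\<Sum>i<Q. z ^ i) = 0" by (simp add: geometric_sum)
  then show ?thesis by (simp add: z_def unit_char_power mult_ac)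
qed

text \<open>This is the Birkhoff sum of the basic character along the orbit of \<open>t\<close>
  under multiplication by 3 modulo 1.\<close>

definition lacunary_sum :: "nat \<Rightarrow> real \<Rightarrow> complex" where
  "lacunary_sum N t = (\<Sum>j<N. unit_char (3 ^ j * t))"

lemma lacunary_sum_add_of_int [simp]: "lacunary_sum N (t + of_int n) = lacunary_sum N t"
proof -
  have "unit_char (3 ^ j * (t + of_int n)) = unit_char (3 ^ j * t)" for j
    using unit_char_add_of_int[of "3 ^ j * t" "3 ^ j * n"] by (simp add: algebra_simps)
  then show ?thesis by (simp add: lacunary_sum_def)
qed

text \<open>This serves to round \<open>t\<close> to the grid of mesh \<open>1 / 3 ^ N\<close>: the
  sum then changes by at most \<open>2 * pi\<close>, a bound independent of
  \<open>N\<close>.\<close>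

lemma norm_lacunary_sum_diff_le:
  "norm (lacunary_sum N s - lacunary_sum N t) \<le> 2 * pi * 3 ^ N * \<bar>s - t\<bar>"
proof -
  have "norm (lacunary_sum N s - lacunary_sum N t)
      \<le> (\<Sum>j<N. norm (unit_char (3 ^ j * s) - unit_char (3 ^ j * t)))"
    unfolding lacunary_sum_def sum_subtractf[symmetric] by (rule norm_sum)
  also have "\<dots> \<le> (\<Sum>j<N. 2 * pi * \<bar>s - t\<bar> * 3 ^ j)"
  proof (rule sum_mono)
    fix j
    show "norm (unit_char (3 ^ j * s) - unit_char (3 ^ j * t)) \<le> 2 * pi * \<bar>s - t\<bar> * 3 ^ j"
      using norm_unit_char_diff_le[of "3 ^ j * s" "3 ^ j * t"]
      by (simp only: right_diff_distrib[symmetric] abs_mult) (simp add: mult_ac)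
  qed
  also have "\<dots> = 2 * pi * \<bar>s - t\<bar> * (\<Sum>j<N. 3 ^ j)"
    by (simp add: sum_distrib_left)
  also have "(\<Sum>j<N. (3::real) ^ j) \<le> 3 ^ N"
    using zero_less_power[of "3::real" N] by (simp add: geometric_sum field_simps)
  then have "2 * pi * \<bar>s - t\<bar> * (\<Sum>j<N. 3 ^ j) \<le> 2 * pi * \<bar>s - t\<bar> * 3 ^ N"
    by (intro mult_left_mono) auto
  finally show ?thesis by (simp add: mult_ac)
qed

text \<open>Discrete Parseval identity: the frequencies \<open>3 ^ j\<close> with
  \<open>j < N\<close> are distinct modulo \<open>3 ^ N\<close>, so their characters are orthogonal
  on the grid and only the diagonal terms survive.\<close>

lemma sum_norm_lacunary_sum_squared:
  "(\<Sum>i<3 ^ N. (norm (lacunary_sum N (real i / 3 ^ N)))\<^sup>2) = 3 ^ N * real N"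
proof -
  define Q :: nat where "Q = 3 ^ N"
  define x where "x i = real i / real Q" for i
  have term_sum: "(\<Sum>i<Q. unit_char (3 ^ j * x i) * cnj (unit_char (3 ^ l * x i))) = (if j = l then of_nat Q else 0)"
    if "j < N" "l < N" for j l
  proof -
    define r :: int where "r = 3 ^ j - 3 ^ l"
    have eq: "unit_char (3 ^ j * x i) * cnj (unit_char (3 ^ l * x i)) = unit_char (of_int r * x i)" for i
      by (simp add: r_def algebra_simps flip: unit_char_minus unit_char_add)
    show ?thesis
    proof (cases "j = l")
      case True
      then show ?thesis unfolding eq by (simp add: r_def unit_char_def)
    next
      case False
      have "\<not> int Q dvd r"
      proof
        assume "int Q dvd r"
        moreover have "r \<noteq> 0" using False by (simp add: r_def)
        ultimately have "int Q \<le> \<bar>r\<bar>" using dvd_imp_le_int[of r "int Q"] by simp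
        moreover have "(3::int) ^ j < 3 ^ N" "(3::int) ^ l < 3 ^ N" using that by simp_all
        moreover have "(3::int) ^ j > 0" "(3::int) ^ l > 0" by simp_all
        ultimately show False unfolding r_def Q_def of_nat_power of_nat_numeral by linarith
      qed
      then show ?thesis
        using sum_unit_char_period[of Q r] False unfolding eq unfolding x_def by (simp add: Q_def)
    qed
  qed
  have "complex_of_real (\<Sum>i<Q. (norm (lacunary_sum N (x i)))\<^sup>2)
      = (\<Sum>i<Q. lacunary_sum N (x i) * cnj (lacunary_sum N (x i)))"
    unfolding of_real_sum complex_norm_square ..
  also have "\<dots> = (\<Sum>i<Q. \<Sum>j<N. \<Sum>l<N. unit_char (3 ^ j * x i) * cnj (unit_char (3 ^ l * x i)))"
    unfolding lacunary_sum_def cnj_sum sum_product ..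
  also have "\<dots> = (\<Sum>j<N. \<Sum>i<Q. \<Sum>l<N. unit_char (3 ^ j * x i) * cnj (unit_char (3 ^ l * x i)))"
    by (rule sum.swap)
  also have "\<dots> = (\<Sum>j<N. \<Sum>l<N. \<Sum>i<Q. unit_char (3 ^ j * x i) * cnj (unit_char (3 ^ l * x i)))"
    by (intro sum.cong refl sum.swap)
  also have "\<dots> = (\<Sum>j<N. \<Sum>l<N. if j = l then of_nat Q else 0)"
    by (intro sum.cong refl) (simp add: term_sum)
  also have "\<dots> = complex_of_real (3 ^ N * real N)"
    by (simp add: Q_def mult.commute)
  finally show ?thesis
    unfolding of_real_eq_iff by (simp add: x_def Q_def)
qed

text \<open>Chebyshev's inequality for the mean square. With \<open>\<tau>\<close> proportional to
  \<open>N\<close>, it leaves only a fraction of order \<open>1 / N\<close> of the grid.\<close>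

lemma card_large_lacunary_sum:
  "real (card {i\<in>{..<3 ^ N}. norm (lacunary_sum N (real i / 3 ^ N)) \<ge> \<tau>}) * \<tau>\<^sup>2 \<le> 3 ^ N * real N"
  if "\<tau> \<ge> 0"
proof -
  define G where "G = {i\<in>{..<(3::nat) ^ N}. norm (lacunary_sum N (real i / 3 ^ N)) \<ge> \<tau>}"
  have "real (card G) * \<tau>\<^sup>2 = (\<Sum>i\<in>G. \<tau>\<^sup>2)" by simp
  also have "\<dots> \<le> (\<Sum>i\<in>G. (norm (lacunary_sum N (real i / 3 ^ N)))\<^sup>2)"
    using that by (intro sum_mono power_mono) (auto simp: G_def)
  also have "\<dots> \<le> (\<Sum>i<3 ^ N. (norm (lacunary_sum N (real i / 3 ^ N)))\<^sup>2)"
    by (intro sum_mono2) (auto simp: G_def)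
  finally show ?thesis unfolding G_def sum_norm_lacunary_sum_squared .
qed

text \<open>With \<open>z = unit_char x\<close>, the base of the power is
  \<open>|1 - z|^2 = (1 - z) * cnj (1 - z)\<close>; expand both factors by the binomial
  theorem.\<close>

lemma sin_power_fourier:
  "complex_of_real ((4 * (sin (pi * x))\<^sup>2) ^ m)
    = (\<Sum>(a, b)\<in>{..m} \<times> {..m}. (-1) ^ (a + b) * of_nat (m choose a) * of_nat (m choose b)
        * unit_char (real_of_int (int a - int b) * x))"
proof -
  define z where "z = unit_char x"
  have binom: "(1 - w) ^ m = (\<Sum>a\<le>m. (-1) ^ a * of_nat (m choose a) * w ^ a)" for w :: complex
  proof -
    have "(1 - w) ^ m = ((- w) + 1) ^ m" by simp
    also have "\<dots> = (\<Sum>a\<le>m. of_nat (m choose a) * (- w) ^ a)"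
      by (subst binomial_ring) simp
    also have "\<dots> = (\<Sum>a\<le>m. (-1) ^ a * of_nat (m choose a) * w ^ a)"
      by (intro sum.cong refl) (simp add: power_minus[of w] mult_ac)
    finally show ?thesis .
  qed
  have "complex_of_real ((4 * (sin (pi * x))\<^sup>2) ^ m) = ((1 - z) * cnj (1 - z)) ^ m"
    by (simp add: z_def complex_norm_square[symmetric] norm_one_minus_unit_char_squared del: complex_cnj_diff)
  also have "\<dots> = (1 - z) ^ m * (1 - cnj z) ^ m"
    by (simp add: power_mult_distrib)
  also have "\<dots> = (\<Sum>a\<le>m. \<Sum>b\<le>m. ((-1) ^ a * of_nat (m choose a) * z ^ a) *
      ((-1) ^ b * of_nat (m choose b) * cnj z ^ b))"
    unfolding binom by (rule sum_product)
  also have "\<dots> = (\<Sum>(a, b)\<in>{..m} \<times> {..m}. ((-1) ^ a * of_nat (m choose a) * z ^ a) *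
      ((-1) ^ b * of_nat (m choose b) * cnj z ^ b))"
    by (simp add: sum.cartesian_product)
  also have "\<dots> = (\<Sum>(a, b)\<in>{..m} \<times> {..m}. (-1) ^ (a + b) * of_nat (m choose a) * of_nat (m choose b)
        * unit_char (real_of_int (int a - int b) * x))"
  proof (intro sum.cong refl, clarify)
    fix a b
    have "z ^ a * cnj z ^ b = unit_char (real_of_int (int a - int b) * x)"
      by (simp add: z_def unit_char_power algebra_simps flip: complex_cnj_power unit_char_minus unit_char_add)
    then show "((-1) ^ a * of_nat (m choose a) * z ^ a) * ((-1) ^ b * of_nat (m choose b) * cnj z ^ b)
      = (-1) ^ (a + b) * of_nat (m choose a) * of_nat (m choose b) * unit_char (real_of_int (int a - int b) * x)"
      by (simp add: power_add mult_ac)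
  qed
  finally show ?thesis .
qed

subsection \<open>The carpet is tube null\<close>

lemma sierpinski_carpet_cases:
  assumes "p \<in> sierpinski_carpet"
  obtains a b :: int and c where "(real_of_int a, real_of_int b) \<in> carpet_digits" "c \<in> sierpinski_carpet"
    "3 * p $ 1 = c $ 1 + of_int a" "3 * p $ 2 = c $ 2 + of_int b"
proof -
  have "p \<in> carpet_step sierpinski_carpet"
    using assms is_sierpinski_carpet_sierpinski_carpet
    unfolding is_sierpinski_carpet_def by blast
  then obtain x y c where xy: "(x, y) \<in> carpet_digits" and c: "c \<in> sierpinski_carpet"
    and p: "p = (1/3) *\<^sub>R c + (1/3) *\<^sub>R vector [x, y]"
    unfolding carpet_step_def by blast
  have "x \<in> {of_int 0, of_int 1, of_int 2}" "y \<in> {of_int 0, of_int 1, of_int 2}"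
    using xy by (auto simp: carpet_digits_def)
  then obtain a b :: int where "x = of_int a" "y = of_int b" by blast
  then show ?thesis
    using that[of a b c] xy c by (simp add: p field_simps)
qed

lemma sierpinski_carpet_unit_square:
  "p \<in> sierpinski_carpet \<Longrightarrow> 0 \<le> p $ i \<and> p $ i \<le> 1"
  using is_sierpinski_carpet_sierpinski_carpet unfolding is_sierpinski_carpet_def by blast

text \<open>An admissible digit pair has an entry 0 or 2, which puts that coordinate in an outer
  third.\<close>

lemma sierpinski_carpet_avoids_center:
  assumes "p \<in> sierpinski_carpet"
  shows "\<exists>i. p $ i \<le> 1 / 3 \<or> 2 / 3 \<le> p $ i"
proof -
  obtain a b :: int and c where ab: "(real_of_int a, real_of_int b) \<in> carpet_digits"
    and c: "c \<in> sierpinski_carpet" and p: "3 * p $ 1 = c $ 1 + of_int a" "3 * p $ 2 = c $ 2 + of_int b"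
    using sierpinski_carpet_cases[OF assms] by metis
  have "a = 0 \<or> a = 2 \<or> b = 0 \<or> b = 2"
    using ab by (auto simp: carpet_digits_def)
  then have "p $ 1 \<le> 1 / 3 \<or> 2 / 3 \<le> p $ 1 \<or> p $ 2 \<le> 1 / 3 \<or> 2 / 3 \<le> p $ 2"
    using p sierpinski_carpet_unit_square[OF c, of 1] sierpinski_carpet_unit_square[OF c, of 2] by auto
  then show ?thesis by blast
qed

text \<open>Each multiplication by 3 moves one more pair of ternary digits into the integer parts
  and leaves a carpet point as remainder.\<close>

lemma sierpinski_carpet_orbit:
  assumes "p \<in> sierpinski_carpet"
  shows "\<exists>(a::int) (b::int). \<exists>c\<in>sierpinski_carpet.
    3 ^ j * p $ 1 = c $ 1 + of_int a \<and> 3 ^ j * p $ 2 = c $ 2 + of_int b"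
proof (induction j)
  case 0
  show ?case
    using assms by (intro exI[of _ "0::int"] bexI[of _ p]) simp_all
next
  case (Suc j)
  then obtain a b :: int and c where c: "c \<in> sierpinski_carpet"
    and eq: "3 ^ j * p $ 1 = c $ 1 + of_int a" "3 ^ j * p $ 2 = c $ 2 + of_int b"
    by blast
  obtain a' b' :: int and d where d: "d \<in> sierpinski_carpet"
    and eq': "3 * c $ 1 = d $ 1 + of_int a'" "3 * c $ 2 = d $ 2 + of_int b'"
    using sierpinski_carpet_cases[OF c] by metis
  have "3 ^ Suc j * p $ 1 = d $ 1 + of_int (3 * a + a')" "3 ^ Suc j * p $ 2 = d $ 2 + of_int (3 * b + b')"
    using eq eq' by simp_all
  then show ?case using d by blast
qed

section \<open>Size of the sine product on the carpet\<close>

lemma sin_pi_squared_le: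
  assumes "0 \<le> x" "x \<le> 1" "x \<le> 1 / 3 \<or> 2 / 3 \<le> x"
  shows "(sin (pi * x))\<^sup>2 \<le> 3 / 4"
proof -
  have *: "(sin (pi * y))\<^sup>2 \<le> 3 / 4" if "0 \<le> y" "y \<le> 1 / 3" for y
  proof -
    have "0 \<le> sin (pi * y)"
      using that by (intro sin_ge_zero) (auto intro!: mult_left_le)
    moreover have "sin (pi * y) \<le> sin (pi / 3)"
      using that by (intro sin_monotone_2pi_le) (auto simp: field_simps intro: order_trans[of _ 0])
    ultimately have "(sin (pi * y))\<^sup>2 \<le> (sin (pi / 3))\<^sup>2"
      by (rule power_mono[rotated])
    then show ?thesis by (simp add: sin_60 power_divide)
  qed
  show ?thesis
  proof (cases "x \<le> 1 / 3")
    case False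
    have "sin (pi * x) = sin (pi * (1 - x))"
      using sin_pi_minus[of "pi * x"] by (simp add: right_diff_distrib)
    then show ?thesis using *[of "1 - x"] False assms by simp
  qed (use * assms in simp)
qed

lemma sin_pi_add_int_squared: "(sin (pi * (x + of_int n)))\<^sup>2 = (sin (pi * x))\<^sup>2"
  by (metis (no_types) norm_one_minus_unit_char_squared unit_char_add_of_int mult_left_cancel zero_neq_numeral)

text \<open>Modulo integers the point is again in the carpet, so one of the bases is at most 3 and
  the other at most 4. The bound matters because the mean of the product over the torus is larger
  than \<open>12 ^ m\<close> for large \<open>m\<close>.\<close>

lemma sin_product_sierpinski_carpet_le:
  assumes "p \<in> sierpinski_carpet"
  shows "(4 * (sin (pi * (3 ^ j * p $ 1)))\<^sup>2) ^ m * (4 * (sin (pi * (3 ^ j * p $ 2)))\<^sup>2) ^ m \<le> 12 ^ m"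
proof -
  obtain a b :: int and c where c: "c \<in> sierpinski_carpet"
    and eq: "3 ^ j * p $ 1 = c $ 1 + of_int a" "3 ^ j * p $ 2 = c $ 2 + of_int b"
    using sierpinski_carpet_orbit[OF assms] by blast
  define s where "s i = (sin (pi * c $ i))\<^sup>2" for i
  have s01: "0 \<le> s i" "s i \<le> 1" for i
    by (auto simp: s_def abs_square_le_1)
  obtain i where "s i \<le> 3 / 4"
    using sierpinski_carpet_avoids_center[OF c] sierpinski_carpet_unit_square[OF c] sin_pi_squared_le
    unfolding s_def by blast
  then have "s 1 \<le> 3 / 4 \<or> s 2 \<le> 3 / 4"
    using exhaust_2[of i] by auto
  then have "s 1 * s 2 \<le> 3 / 4"
  proof
    assume "s 1 \<le> 3 / 4"
    then show ?thesis using mult_mono[of "s 1" "3 / 4" "s 2" 1] s01 by simp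
  next
    assume "s 2 \<le> 3 / 4"
    then show ?thesis using mult_mono[of "s 1" 1 "s 2" "3 / 4"] s01 by simp
  qed
  then have "((4 * s 1) * (4 * s 2)) ^ m \<le> 12 ^ m"
    using s01 by (intro power_mono) auto
  then show ?thesis
    unfolding eq sin_pi_add_int_squared s_def power_mult_distrib .
qed

text \<open>Sum the Fourier expansion of the sine product along the orbit of \<open>p\<close>. The
  constant term contributes \<open>B\<^sup>2 * N\<close>, but the total is at most
  \<open>12 ^ m * N\<close>, so the nonconstant terms must make up the difference and one of their
  lacunary sums is large.\<close>

lemma sierpinski_carpet_large_lacunary_sum:
  "\<exists>(K :: (int \<times> int) set) c. finite K \<and> (0, 0) \<notin> K \<and> c > 0 \<and>
     (\<forall>p\<in>sierpinski_carpet. \<forall>N>0. \<exists>(k, l)\<in>K.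
        c * real N \<le> norm (lacunary_sum N (of_int k * p $ 1 + of_int l * p $ 2)))"
proof -
  \<comment> \<open>It is enough that \<open>16 ^ m / (4 * m\<^sup>2)\<close>, a lower bound for the
    squared central binomial coefficient \<open>B\<^sup>2\<close>, exceeds
    \<open>12 ^ m\<close>.\<close>
  define m :: nat where "m = 30"
  define I where "I = ({..m} \<times> {..m}) \<times> ({..m} \<times> {..m})"
  define coef :: "(nat \<times> nat) \<times> (nat \<times> nat) \<Rightarrow> real" where
    "coef = (\<lambda>((a, b), (c, d)). (-1) ^ (a + b) * (m choose a) * (m choose b) *
        ((-1) ^ (c + d) * (m choose c) * (m choose d)))"
  define freq :: "(nat \<times> nat) \<times> (nat \<times> nat) \<Rightarrow> int \<times> int" where
    "freq = (\<lambda>((a, b), (c, d)). (int a - int b, int c - int d))"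
  define phase :: "(nat \<times> nat) \<times> (nat \<times> nat) \<Rightarrow> real^2 \<Rightarrow> real" where
    "phase i p = of_int (fst (freq i)) * p $ 1 + of_int (snd (freq i)) * p $ 2" for i p
  define I0 where "I0 = {i \<in> I. freq i = (0, 0)}"
  define I1 where "I1 = {i \<in> I. freq i \<noteq> (0, 0)}"
  have finI: "finite I" "finite I0" "finite I1" by (auto simp: I_def I0_def I1_def)
  define A where "A = (\<Sum>i\<in>I1. \<bar>coef i\<bar>)"
  define B where "B = real ((2 * m) choose m)"
  define D where "D = B\<^sup>2 - 12 ^ m"
  have D: "D > 0"
  proof -
    have "4 ^ m / (2 * real m) \<le> B"
      unfolding B_def by (rule central_binomial_lower_bound) (simp add: m_def)
    then have "(4 ^ m / (2 * real m))\<^sup>2 \<le> B\<^sup>2"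
      by (rule power_mono) simp
    moreover have "(12::real) ^ m < (4 ^ m / (2 * real m))\<^sup>2"
      by (simp add: m_def power2_eq_square)
    ultimately show ?thesis by (simp add: D_def)
  qed
  \<comment> \<open>Zero frequency means equal indices in each pair, so all signs are positive; the
    sums of squared binomial coefficients are central binomial coefficients.\<close>
  have coef0: "(\<Sum>i\<in>I0. coef i) = B\<^sup>2"
  proof -
    have "(\<Sum>i\<in>I0. coef i) = (\<Sum>(a, c)\<in>{..m} \<times> {..m}. (real (m choose a))\<^sup>2 * (real (m choose c))\<^sup>2)"
      by (rule sum.reindex_bij_witness[of _ "\<lambda>(a, c). ((a, a), (c, c))" "\<lambda>((a, b), (c, d)). (a, c)"])
        (auto simp: I0_def I_def freq_def coef_def power2_eq_square simp flip: mult_2)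
    also have "\<dots> = (\<Sum>a\<le>m. (real (m choose a))\<^sup>2) * (\<Sum>c\<le>m. (real (m choose c))\<^sup>2)"
      by (simp add: sum_product sum.cartesian_product)
    also have "(\<Sum>a\<le>m. (real (m choose a))\<^sup>2) = B"
      unfolding B_def choose_square_sum[symmetric] by simp
    finally show ?thesis by (simp add: power2_eq_square)
  qed
  \<comment> \<open>Adding 1 avoids division by zero and makes \<open>A * c < D\<close> strict,
    which is the final contradiction.\<close>
  define c where "c = D / (A + 1)"
  have A: "A \<ge> 0" by (simp add: A_def sum_nonneg)
  have c: "c > 0" using D A by (simp add: c_def)
  have "\<exists>(k, l)\<in>freq ` I1. c * real N \<le> norm (lacunary_sum N (of_int k * p $ 1 + of_int l * p $ 2))"
    if p: "p \<in> sierpinski_carpet" and N: "N > 0" for p N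
  proof (rule ccontr)
    assume "\<not> ?thesis"
    then have small: "norm (lacunary_sum N (phase i p)) < c * real N" if "i \<in> I1" for i
      using that by (force simp: phase_def)
    have expand: "complex_of_real ((4 * (sin (pi * (3 ^ j * p $ 1)))\<^sup>2) ^ m * (4 * (sin (pi * (3 ^ j * p $ 2)))\<^sup>2) ^ m)
        = (\<Sum>i\<in>I. of_real (coef i) * unit_char (3 ^ j * phase i p))" for j
      unfolding of_real_mult sin_power_fourier sum_product sum.cartesian_product I_def
      by (intro sum.cong refl)
        (auto simp: coef_def phase_def freq_def distrib_left unit_char_add mult_ac)
    have "complex_of_real (\<Sum>j<N. (4 * (sin (pi * (3 ^ j * p $ 1)))\<^sup>2) ^ m * (4 * (sin (pi * (3 ^ j * p $ 2)))\<^sup>2) ^ m)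
        = (\<Sum>j<N. \<Sum>i\<in>I. of_real (coef i) * unit_char (3 ^ j * phase i p))"
      unfolding of_real_sum expand ..
    also have "\<dots> = (\<Sum>i\<in>I. \<Sum>j<N. of_real (coef i) * unit_char (3 ^ j * phase i p))"
      by (rule sum.swap)
    also have "\<dots> = (\<Sum>i\<in>I. of_real (coef i) * lacunary_sum N (phase i p))"
      by (simp add: lacunary_sum_def sum_distrib_left)
    also have "I = I0 \<union> I1" by (auto simp: I0_def I1_def)
    also have "(\<Sum>i\<in>I0 \<union> I1. of_real (coef i) * lacunary_sum N (phase i p))
        = (\<Sum>i\<in>I0. of_real (coef i) * lacunary_sum N (phase i p))
          + (\<Sum>i\<in>I1. of_real (coef i) * lacunary_sum N (phase i p))"
      by (rule sum.union_disjoint) (use finI in \<open>auto simp: I0_def I1_def\<close>)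
    also have "(\<Sum>i\<in>I0. of_real (coef i) * lacunary_sum N (phase i p))
        = (\<Sum>i\<in>I0. of_real (coef i) * of_nat N)"
      by (intro sum.cong refl) (simp add: I0_def phase_def lacunary_sum_def unit_char_def)
    also have "\<dots> = of_real (B\<^sup>2 * real N)"
      unfolding coef0[symmetric] by (simp add: sum_distrib_right)
    finally have eq: "(\<Sum>i\<in>I1. of_real (coef i) * lacunary_sum N (phase i p))
        = complex_of_real ((\<Sum>j<N. (4 * (sin (pi * (3 ^ j * p $ 1)))\<^sup>2) ^ m * (4 * (sin (pi * (3 ^ j * p $ 2)))\<^sup>2) ^ m)
            - B\<^sup>2 * real N)"
      (is "_ = complex_of_real (?S - _)") by simp
    have "?S \<le> (\<Sum>j<N. 12 ^ m)"
      by (intro sum_mono sin_product_sierpinski_carpet_le p)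
    then have "D * real N \<le> B\<^sup>2 * real N - ?S"
      by (simp add: D_def algebra_simps)
    also have "\<dots> \<le> norm (\<Sum>i\<in>I1. of_real (coef i) * lacunary_sum N (phase i p))"
      unfolding eq norm_of_real by simp
    also have "\<dots> \<le> (\<Sum>i\<in>I1. norm (of_real (coef i) * lacunary_sum N (phase i p)))"
      by (rule norm_sum)
    also have "\<dots> \<le> (\<Sum>i\<in>I1. \<bar>coef i\<bar> * (c * real N))"
      unfolding norm_mult norm_of_real
      by (intro sum_mono mult_left_mono less_imp_le[OF small]) auto
    also have "\<dots> = A * c * real N"
      by (simp add: A_def sum_distrib_right mult.assoc)
    finally have "D \<le> A * c" using N by simp
    moreover have "A * c < (A + 1) * c" using c by simp
    moreover have "(A + 1) * c = D" using A by (simp add: c_def)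
    ultimately show False by simp
  qed
  moreover have "finite (freq ` I1)" "(0, 0) \<notin> freq ` I1"
    using finI by (auto simp: I1_def)
  ultimately show ?thesis using c by blast
qed

text \<open>For each frequency \<open>(k, l)\<close>, the tubes follow the lines
  \<open>k * x + l * y = n + i / Q\<close> with \<open>i\<close> in the exceptional set
  \<open>G\<close>. There are of order \<open>Q / N\<close> such tubes, each with vector of length
  of order \<open>1 / Q\<close>, so the total is of order \<open>1 / N\<close>.\<close>

lemma sierpinski_carpet_tube_null:
  assumes \<eta>: "\<eta> > 0"
  shows "\<exists>(J :: ((int \<times> int) \<times> int \<times> nat) set) (v :: _ \<Rightarrow> real^2) \<alpha>.
    finite J \<and> (\<Sum>j\<in>J. norm (v j)) \<le> \<eta> \<and>
    (\<forall>p\<in>sierpinski_carpet. \<exists>j\<in>J. \<bar>v j \<bullet> p - \<alpha> j\<bar> < (norm (v j))\<^sup>2 / 2)"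
proof -
  obtain K :: "(int \<times> int) set" and c where K: "finite K" "(0, 0) \<notin> K" and c: "c > 0"
    and large: "\<And>p N. p \<in> sierpinski_carpet \<Longrightarrow> N > 0 \<Longrightarrow> \<exists>(k, l)\<in>K.
        c * real N \<le> norm (lacunary_sum N (of_int k * p $ 1 + of_int l * p $ 2))"
    using sierpinski_carpet_large_lacunary_sum by metis
  \<comment> \<open>\<open>W\<close> bounds both the lengths of the frequency vectors and the values
    of \<open>k * x + l * y\<close> on the unit square.\<close>
  define W where "W = (\<Sum>(k, l)\<in>K. nat \<bar>k\<bar> + nat \<bar>l\<bar>)"
  have W: "\<bar>real_of_int k\<bar> + \<bar>real_of_int l\<bar> \<le> real W" if "(k, l) \<in> K" for k l
  proof -
    have "nat \<bar>k\<bar> + nat \<bar>l\<bar> \<le> W"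
      using member_le_sum[of "(k, l)" K "\<lambda>(k, l). nat \<bar>k\<bar> + nat \<bar>l\<bar>"] that K by (simp add: W_def)
    then show ?thesis by linarith
  qed
  define C where "C = real (card K) * (2 * real W + 1) * (12 * real W / c\<^sup>2)"
  have C: "C \<ge> 0" by (simp add: C_def)
  \<comment> \<open>The first bound keeps the rounding loss \<open>2 * pi\<close> below
    \<open>c * N / 2\<close>; the second makes the total length \<open>C / N\<close> at most
    \<open>\<eta>\<close>.\<close>
  obtain N :: nat where N: "real N > max (4 * pi / c) (C / \<eta>)"
    using reals_Archimedean2 by blast
  have N1: "c * real N > 4 * pi" and N2: "C < \<eta> * real N"
    using N c \<eta> by (simp_all add: field_simps)
  have N0: "N > 0"
    using N1 c pi_gt_zero by (intro gr0I) auto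
  define Q :: real where "Q = 3 ^ N"
  have Q: "Q \<ge> 1" by (simp add: Q_def)
  \<comment> \<open>Half the threshold \<open>c * N\<close> is used, so that the grid point next to
    a large value still qualifies after rounding.\<close>
  define G where "G = {i\<in>{..<3 ^ N}. norm (lacunary_sum N (real i / 3 ^ N)) \<ge> c * real N / 2}"
  have G: "real (card G) * (3 / Q * real W) \<le> 12 * real W / (c\<^sup>2 * real N)"
  proof -
    have "real (card G) * (c * real N / 2)\<^sup>2 \<le> Q * real N"
      unfolding G_def Q_def by (rule card_large_lacunary_sum) (use c in simp)
    then have "real (card G) * (c\<^sup>2 * real N) \<le> 4 * Q"
      using N0 by (simp add: power2_eq_square field_simps)
    then have "real (card G) * (c\<^sup>2 * real N) * (3 * real W) \<le> 4 * Q * (3 * real W)"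
      by (rule mult_right_mono) simp
    moreover have "c\<^sup>2 * real N > 0" using c N0 by simp
    ultimately show ?thesis
      using Q by (simp add: field_simps)
  qed
  define J where "J = K \<times> {- int W..int W} \<times> G"
  \<comment> \<open>Rounding puts \<open>v j \<bullet> p\<close> within \<open>3 / Q\<^sup>2\<close>
    of \<open>\<alpha> j\<close>, while half the squared length of \<open>v j\<close> is at least
    \<open>9 / (2 * Q\<^sup>2)\<close>, since a nonzero integer vector has length at least 1. Any
    factor above 2 in place of 3 gives this comparison.\<close>
  define v :: "(int \<times> int) \<times> int \<times> nat \<Rightarrow> real^2" where
    "v = (\<lambda>((k, l), n, i). (3 / Q) *\<^sub>R vector [of_int k, of_int l])"
  define \<alpha> :: "(int \<times> int) \<times> int \<times> nat \<Rightarrow> real" where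
    "\<alpha> = (\<lambda>((k, l), n, i). (3 / Q) * (of_int n + real i / Q))"
  have finJ: "finite J" using K by (simp add: J_def G_def)
  have cardJ: "real (card J) = real (card K) * (2 * real W + 1) * real (card G)"
    by (simp add: J_def card_cartesian_product)
  have "norm (v j) \<le> 3 / Q * real W" if "j \<in> J" for j
  proof -
    obtain k l n i where j: "j = ((k, l), n, i)" by (metis prod.exhaust)
    have "norm (vector [of_int k, of_int l] :: real^2) \<le> \<bar>real_of_int k\<bar> + \<bar>real_of_int l\<bar>"
      using norm_le_l1_cart[of "vector [of_int k, of_int l] :: real^2"] by (simp add: sum_2)
    also have "\<dots> \<le> real W" using that by (intro W) (simp add: j J_def)
    finally show ?thesis
      using Q by (simp add: j v_def divide_right_mono)
  qed
  then have "(\<Sum>j\<in>J. norm (v j)) \<le> real (card J) * (3 / Q * real W)"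
    by (rule sum_bounded_above)
  also have "\<dots> = real (card K) * (2 * real W + 1) * (real (card G) * (3 / Q * real W))"
    by (simp add: cardJ)
  also have "\<dots> \<le> real (card K) * (2 * real W + 1) * (12 * real W / (c\<^sup>2 * real N))"
    by (intro mult_left_mono G) auto
  also have "\<dots> = C / real N" by (simp add: C_def)
  also have "\<dots> \<le> \<eta>" using N2 N0 by (simp add: field_simps)
  finally have total: "(\<Sum>j\<in>J. norm (v j)) \<le> \<eta>" .
  have "\<exists>j\<in>J. \<bar>v j \<bullet> p - \<alpha> j\<bar> < (norm (v j))\<^sup>2 / 2" if p: "p \<in> sierpinski_carpet" for p
  proof -
    obtain k l where kl: "(k, l) \<in> K"
      and ge: "c * real N \<le> norm (lacunary_sum N (of_int k * p $ 1 + of_int l * p $ 2))"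
      using large[OF p N0] by blast
    define t where "t = of_int k * p $ 1 + of_int l * p $ 2"
    define n where "n = \<lfloor>t\<rfloor>"
    define i where "i = nat \<lfloor>frac t * Q\<rfloor>"
    have t: "t = frac t + of_int n" by (simp add: n_def frac_def)
    have "\<bar>t\<bar> \<le> \<bar>of_int k\<bar> * \<bar>p $ 1\<bar> + \<bar>of_int l\<bar> * \<bar>p $ 2\<bar>"
      unfolding t_def abs_mult[symmetric] by (rule abs_triangle_ineq)
    also have "\<dots> \<le> \<bar>real_of_int k\<bar> * 1 + \<bar>real_of_int l\<bar> * 1"
      using sierpinski_carpet_unit_square[OF p] by (intro add_mono mult_left_mono) auto
    also have "\<dots> \<le> real W" using W[OF kl] by simp
    finally have "n \<in> {- int W..int W}"
      by (auto simp: n_def le_floor_iff floor_le_iff abs_le_iff)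
    have ireal: "real i = of_int \<lfloor>frac t * Q\<rfloor>"
      using Q by (simp add: i_def)
    then have i_le: "real i \<le> frac t * Q" and i_gt: "frac t * Q < real i + 1"
      by linarith+
    have near: "\<bar>frac t - real i / Q\<bar> \<le> 1 / Q"
    proof -
      have "frac t - real i / Q = (frac t * Q - real i) / Q"
        using Q by (simp add: field_simps)
      moreover have "\<bar>frac t * Q - real i\<bar> \<le> 1"
        using i_le i_gt by linarith
      ultimately show ?thesis
        using Q by (simp add: abs_divide divide_right_mono)
    qed
    have "frac t * Q < 1 * Q"
      using Q by (intro mult_strict_right_mono frac_lt_1) simp
    then have "real i < Q"
      using i_le by linarith
    then have "real i < real (3 ^ N)"
      by (simp only: Q_def of_nat_power of_nat_numeral)
    then have "i < 3 ^ N" by (simp only: of_nat_less_iff)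
    moreover have "c * real N / 2 \<le> norm (lacunary_sum N (real i / Q))"
    proof -
      have "lacunary_sum N t = lacunary_sum N (frac t)"
        by (subst t) (rule lacunary_sum_add_of_int)
      then have "c * real N \<le> norm (lacunary_sum N (frac t))"
        using ge by (simp add: t_def)
      moreover have "norm (lacunary_sum N (frac t) - lacunary_sum N (real i / Q)) \<le> 2 * pi"
      proof -
        have "norm (lacunary_sum N (frac t) - lacunary_sum N (real i / Q))
            \<le> 2 * pi * Q * \<bar>frac t - real i / Q\<bar>"
          unfolding Q_def by (rule norm_lacunary_sum_diff_le)
        also have "\<dots> \<le> 2 * pi * Q * (1 / Q)"
          using Q by (intro mult_left_mono near) auto
        finally show ?thesis using Q by simp
      qed
      moreover have "norm (lacunary_sum N (frac t)) \<le> norm (lacunary_sum N (real i / Q))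
          + norm (lacunary_sum N (frac t) - lacunary_sum N (real i / Q))"
        by (metis norm_triangle_sub)
      ultimately show ?thesis using N1 by linarith
    qed
    ultimately have "i \<in> G" by (simp add: G_def Q_def)
    define j where "j = ((k, l), n, i)"
    have "j \<in> J"
      using kl \<open>n \<in> _\<close> \<open>i \<in> G\<close> by (simp add: j_def J_def)
    moreover have "\<bar>v j \<bullet> p - \<alpha> j\<bar> < (norm (v j))\<^sup>2 / 2"
    proof -
      have "v j \<bullet> p - \<alpha> j = 3 / Q * (t - of_int n - real i / Q)"
        by (simp add: v_def \<alpha>_def j_def t_def inner_vec_def sum_2 right_diff_distrib distrib_left)
      also have "t - of_int n = frac t" using t by simp
      finally have eq: "v j \<bullet> p - \<alpha> j = 3 / Q * (frac t - real i / Q)" .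
      have "\<bar>v j \<bullet> p - \<alpha> j\<bar> = 3 / Q * \<bar>frac t - real i / Q\<bar>"
        unfolding eq abs_mult using Q by simp
      also have "\<dots> \<le> 3 / Q * (1 / Q)"
        using Q by (intro mult_left_mono near) auto
      also have "\<dots> < 9 / Q\<^sup>2 * 1 / 2"
        using Q by (simp add: power2_eq_square field_simps)
      also have "\<dots> \<le> 9 / Q\<^sup>2 * (of_int (k\<^sup>2 + l\<^sup>2)) / 2"
      proof -
        have "k\<^sup>2 + l\<^sup>2 \<noteq> 0" using kl K by auto
        moreover have "k\<^sup>2 + l\<^sup>2 \<ge> 0" by simp
        ultimately have "1 \<le> k\<^sup>2 + l\<^sup>2" by linarith
        then have "(1::real) \<le> of_int (k\<^sup>2 + l\<^sup>2)" by linarith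
        then show ?thesis by (intro divide_right_mono mult_left_mono) auto
      qed
      also have "9 / Q\<^sup>2 * (of_int (k\<^sup>2 + l\<^sup>2)) = (norm (v j))\<^sup>2"
        unfolding power2_norm_eq_inner
        by (simp add: v_def j_def inner_vec_def sum_2 power2_eq_square algebra_simps add_divide_distrib)
      finally show ?thesis .
    qed
    ultimately show ?thesis by blast
  qed
  then show ?thesis using finJ total by blast
qed

section \<open>From tubes to segments\<close>

theorem mainTheorem6:
  fixes \<epsilon> :: real
  assumes "\<epsilon> > 0"
  shows "\<exists>f :: real^2 \<Rightarrow> real^2.
           1-lipschitz_on sierpinski_carpet f \<and>
           (\<forall>x\<in>sierpinski_carpet. norm (f x - x) \<le> \<epsilon>) \<and>
           (\<exists>S :: ((real^2) \<times> (real^2)) set. finite S \<and>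
              f ` sierpinski_carpet \<subseteq> (\<Union>(p, q)\<in>S. closed_segment p q))"
proof -
  obtain J :: "((int \<times> int) \<times> int \<times> nat) set" and v :: "_ \<Rightarrow> real^2" and \<alpha> where
    J: "finite J" "(\<Sum>j\<in>J. norm (v j)) \<le> \<epsilon>"
    and tubes: "\<And>p. p \<in> sierpinski_carpet \<Longrightarrow> \<exists>j\<in>J. \<bar>v j \<bullet> p - \<alpha> j\<bar> < (norm (v j))\<^sup>2 / 2"
    using sierpinski_carpet_tube_null[OF assms] by blast
  obtain f :: "real^2 \<Rightarrow> real^2" and H where f_lip: "1-lipschitz_on UNIV f"
    and near: "\<And>p. norm (f p - p) \<le> (\<Sum>j\<in>J. norm (v j))"
    and H: "finite H" "\<And>u c. (u, c) \<in> H \<Longrightarrow> u \<noteq> 0"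
    and lines: "\<And>p. \<exists>j\<in>J. \<bar>v j \<bullet> p - \<alpha> j\<bar> < (norm (v j))\<^sup>2 / 2 \<Longrightarrow> \<exists>(u, c)\<in>H. u \<bullet> f p = c"
    using ex_nonexpansive_collapse_tubes[OF J(1), of v \<alpha>] by blast
  have f_near: "norm (f p - p) \<le> \<epsilon>" for p
    using near[of p] J(2) by linarith
  \<comment> \<open>Carpet points have norm at most 2 and move by at most \<open>\<epsilon>\<close>,
    so only the part of each line in this ball matters, and it lies in a segment.\<close>
  have "\<exists>s. \<forall>q\<in>cball 0 (2 + \<epsilon>). fst h \<bullet> q = snd h \<longrightarrow> q \<in> closed_segment (fst s) (snd s)"
    if "h \<in> H" for h
  proof -
    have "fst h \<noteq> 0" using H(2)[of "fst h" "snd h"] that by simp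
    then obtain a b where "{q \<in> cball 0 (2 + \<epsilon>). fst h \<bullet> q = snd h} \<subseteq> closed_segment a b"
      using line_Int_cball_subset_segment by blast
    then show ?thesis by (intro exI[of _ "(a, b)"]) auto
  qed
  then obtain seg where seg: "\<And>h q. h \<in> H \<Longrightarrow> q \<in> cball 0 (2 + \<epsilon>) \<Longrightarrow> fst h \<bullet> q = snd h
      \<Longrightarrow> q \<in> closed_segment (fst (seg h)) (snd (seg h))"
    by metis
  have "f p \<in> (\<Union>(a, b)\<in>seg ` H. closed_segment a b)" if p: "p \<in> sierpinski_carpet" for p
  proof -
    obtain u c where h: "(u, c) \<in> H" "u \<bullet> f p = c"
      using lines[OF tubes[OF p]] by blast
    have "norm p \<le> \<bar>p $ 1\<bar> + \<bar>p $ 2\<bar>"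
      using norm_le_l1_cart[of p] by (simp add: sum_2)
    also have "\<dots> \<le> 2"
      using sierpinski_carpet_unit_square[OF p, of 1] sierpinski_carpet_unit_square[OF p, of 2] by simp
    finally have "norm (f p) \<le> 2 + \<epsilon>"
      using f_near[of p] norm_triangle_sub[of "f p" p] by linarith
    then have "f p \<in> closed_segment (fst (seg (u, c))) (snd (seg (u, c)))"
      using seg[OF h(1), of "f p"] h(2) by simp
    then show ?thesis using h(1) by (auto simp: case_prod_unfold)
  qed
  then show ?thesis
    using lipschitz_on_subset[OF f_lip subset_UNIV] f_near H(1)
    by (intro exI[of _ f] conjI ballI exI[of _ "seg ` H"]) auto
qed

end
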